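(* A typical map in $\mathcal C[0,1]$ is not expansive in the future.
   Context: $\mathcal C[0,1]$ is the space of continuous maps of $[0,1]$ to itself, with the uniform metric. A property is typical ("a typical map has it") if there is a dense $G_\delta$ subset $G\subset\mathcal C[0,1]$ such that all $f\in G$ have the property. A map $f\in\mathcal C[0,1]$ is expansive in the future if there exists a constant $\alpha>0$ such that for any two points $x,y\in[0,1]$, if $|f^n(x)-f^n(y)|\le\alpha$ for all $n\in\mathbb N$, then $x=y$. *)

theory Defs
  imports "HOL-Analysis.Analysis"
begin

text \<open>Self-maps of the unit interval are represented by functions on the reals that are
  extensional on the interval, so that distinct elements of the space are distinct as maps.\<close>

definition C01 :: "(real \<Rightarrow> real) metric" where
  "C01 = cfunspace (top_of_set {0..1}) (submetric euclidean_metric {0..1})"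

definition typically :: "'a topology \<Rightarrow> ('a \<Rightarrow> bool) \<Rightarrow> bool" where
  "typically X P \<longleftrightarrow> (\<exists>G. gdelta_in X G \<and> X closure_of G = topspace X \<and> (\<forall>f\<in>G. P f))"

text \<open>The iterates include the zeroth one, the identity.\<close>

definition expansive_in_future :: "(real \<Rightarrow> real) \<Rightarrow> bool" where
  "expansive_in_future f \<longleftrightarrow>
    (\<exists>\<alpha>>0. \<forall>x\<in>{0..1}. \<forall>y\<in>{0..1}. (\<forall>n. \<bar>(f ^^ n) x - (f ^^ n) y\<bar> \<le> \<alpha>) \<longrightarrow> x = y)"

lemma mtopology_unit_interval:
  "mtopology_of (submetric euclidean_metric {0..1::real}) = top_of_set {0..1}"
  by (simp add: mtopology_of_submetric)

lemma mspace_C01: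
  "mspace C01 = {f \<in> extensional {0..1}. continuous_on {0..1} f \<and> f ` {0..1} \<subseteq> {0..1}}"
    (is "?L = ?R")
proof (intro set_eqI iffI)
  fix f assume "f \<in> ?L"
  then show "f \<in> ?R"
    by (auto simp: C01_def mtopology_unit_interval continuous_map_in_subtopology)
next
  fix f assume f: "f \<in> ?R"
  interpret S: Metric_space "{0..1::real}" dist
    by unfold_locales (auto simp: dist_commute dist_triangle)
  have "S.mbounded (f ` {0..1})"
    unfolding S.mbounded_def S.mcball_def
    using f by (intro exI[of _ 0] exI[of _ 1]) (auto simp: dist_real_def)
  with f show "f \<in> ?L"
    by (auto simp: C01_def mtopology_unit_interval continuous_map_in_subtopology)
qed

lemma mdist_C01:
  assumes "f \<in> mspace C01" "g \<in> mspace C01"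
  shows "mdist C01 f g = (SUP x\<in>{0..1}. \<bar>f x - g x\<bar>)"
proof -
  interpret S: Metric_space "{0..1::real}" dist
    by unfold_locales (auto simp: dist_commute dist_triangle)
  have "f \<in> S.fspace {0..1}" "g \<in> S.fspace {0..1}"
    using assms by (auto simp: C01_def cfunspace_def)
  then show ?thesis
    by (simp add: C01_def mdist_cfunspace_eq_mdist_funspace S.fdist_def dist_real_def)
qed

end

theory Submission
  imports Defs
begin

text \<open>No continuous self-map of a nondegenerate compact interval is expansive in the future, so
  the whole space serves as the dense \<open>G\<^sub>\<delta>\<close> set.

  Let \<open>f\<close> be such a map and \<open>\<alpha> > 0\<close>. Suppose first that \<open>f x = f y\<close> for some distinct
  \<open>x\<close>, \<open>y\<close>. Between them \<open>f\<close> has a local extremum, near which it is not injective; so there are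
  such \<open>x\<close>, \<open>y\<close> with \<open>\<bar>x - y\<bar> \<le> \<alpha>\<close>, and their orbits agree from time one on
  (\<open>locally_injective_imp_inj_on_interval\<close>).

  Otherwise \<open>f\<close> is injective, hence strictly monotone, and \<open>f \<circ> f\<close> is strictly increasing.
  The orbit of any point under \<open>f \<circ> f\<close> is then monotone and bounded, so it converges; by
  continuity its image under \<open>f\<close> converges too, and \<open>f\<^sup>n\<^sup>+\<^sup>2 x - f\<^sup>n x\<close> tends to \<open>0\<close>.
  A point \<open>y\<close> between \<open>x\<close> and \<open>f (f x)\<close> has
  its orbit squeezed between those of \<open>x\<close> and \<open>f (f x)\<close>, which takes care of all late times;
  the finitely many early times are handled by continuity, on taking \<open>y\<close> close to \<open>x\<close>
  (\<open>inj_interval_map_close_orbits\<close>). If \<open>f \<circ> f\<close> is the identity, there are only two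
  times to consider.\<close>

text \<open>If injectivity failed globally, \<open>f\<close> would attain an extremum strictly between two points
  with equal values, but a continuous map that is injective near an interior point is strictly
  monotone there.\<close>

lemma locally_injective_imp_inj_on_interval:
  fixes f :: "real \<Rightarrow> real"
  assumes cont: "continuous_on {a..b} f" and "\<delta> > 0"
    and inj: "\<And>x y. x \<in> {a..b} \<Longrightarrow> y \<in> {a..b} \<Longrightarrow> \<bar>x - y\<bar> \<le> \<delta> \<Longrightarrow> f x = f y \<Longrightarrow> x = y"
  shows "inj_on f {a..b}"
proof (rule linorder_inj_onI)
  fix x y assume "x < y" and xy: "x \<in> {a..b}" "y \<in> {a..b}"
  show "f x \<noteq> f y"
  proof
    assume eq: "f x = f y"
    have no_extremum: False
      if c: "x < c" "c < y" and ext: "(\<forall>t\<in>{x..y}. f t \<le> f c) \<or> (\<forall>t\<in>{x..y}. f c \<le> f t)" for c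
    proof -
      define r where "r = min (\<delta> / 2) (min (c - x) (y - c))"
      have r: "r > 0" "2 * r \<le> \<delta>" "x \<le> c - r" "c + r \<le> y"
        using c \<open>\<delta> > 0\<close> by (auto simp: r_def min_def)
      have "continuous_on {c - r..c + r} f"
        using r xy by (intro continuous_on_subset[OF cont]) auto
      moreover have "inj_on f {c - r..c + r}"
        by (rule inj_onI) (rule inj, use r xy in auto)
      ultimately have "f (c - r) < f c \<and> f c < f (c + r) \<or> f (c + r) < f c \<and> f c < f (c - r)"
        using r by (intro continuous_inj_imp_mono) auto
      moreover have "c - r \<in> {x..y}" "c + r \<in> {x..y}"
        using r by auto
      ultimately show False
        using ext by (meson not_less)
    qed
    have cont': "continuous_on {x..y} f"
      using xy by (intro continuous_on_subset[OF cont]) auto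
    obtain c where c: "c \<in> {x..y}" "\<forall>t\<in>{x..y}. f t \<le> f c"
      using continuous_attains_sup[OF _ _ cont'] \<open>x < y\<close> by auto
    obtain d where d: "d \<in> {x..y}" "\<forall>t\<in>{x..y}. f d \<le> f t"
      using continuous_attains_inf[OF _ _ cont'] \<open>x < y\<close> by auto
    have "c = x \<or> c = y" "d = x \<or> d = y"
      using no_extremum[of c] no_extremum[of d] c d by force+
    \<comment> \<open>Both extreme values are taken at the ends, where \<open>f\<close> takes the same value; so \<open>f\<close> is
      constant on \<open>{x..y}\<close> and the midpoint is an interior extremum after all.\<close>
    then have "f c = f d"
      using eq by auto
    moreover have "(x + y) / 2 \<in> {x..y}"
      using \<open>x < y\<close> by auto
    ultimately have "\<forall>t\<in>{x..y}. f t \<le> f ((x + y) / 2)"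
      using c(2) d(2) by (metis order_trans)
    then show False
      using no_extremum[of "(x + y) / 2"] \<open>x < y\<close> by auto
  qed
qed auto

lemma funpow_maps_to:
  assumes "f ` S \<subseteq> S" "x \<in> S"
  shows "(f ^^ n) x \<in> S"
  using assms by (induction n) auto

lemma continuous_on_funpow:
  fixes f :: "'a::topological_space \<Rightarrow> 'a"
  assumes "continuous_on S f" "f ` S \<subseteq> S"
  shows "continuous_on S (f ^^ n)"
proof (induction n)
  case (Suc n)
  have "continuous_on ((f ^^ n) ` S) f"
    using assms funpow_maps_to[of f S] by (intro continuous_on_subset[OF assms(1)]) auto
  with Suc show ?case
    unfolding funpow.simps by (rule continuous_on_compose)
qed simp

lemma inj_on_funpow:
  assumes "inj_on f S" "f ` S \<subseteq> S"
  shows "inj_on (f ^^ n) S"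
proof (induction n)
  case (Suc n)
  have "inj_on f ((f ^^ n) ` S)"
    using assms funpow_maps_to[of f S] by (intro inj_on_subset[OF assms(1)]) auto
  with Suc show ?case
    unfolding funpow.simps by (rule comp_inj_on)
qed simp

lemma finite_orbits_close:
  fixes f :: "real \<Rightarrow> real"
  assumes "continuous_on S f" "f ` S \<subseteq> S" "x \<in> S" "\<alpha> > 0"
  shows "\<exists>\<delta>>0. \<forall>y\<in>S. \<bar>y - x\<bar> < \<delta> \<longrightarrow> (\<forall>n<N. \<bar>(f ^^ n) x - (f ^^ n) y\<bar> \<le> \<alpha>)"
proof -
  have "\<forall>\<^sub>F y in at x within S. \<forall>n\<in>{..<N}. dist ((f ^^ n) y) ((f ^^ n) x) < \<alpha>"
    using continuous_on_funpow[OF assms(1,2)] assms(3,4)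
    by (intro eventually_ball_finite ballI tendstoD) (auto simp: continuous_on)
  then obtain \<delta> where "\<delta> > 0" and
    "\<forall>y\<in>S. y \<noteq> x \<and> dist y x < \<delta> \<longrightarrow> (\<forall>n\<in>{..<N}. dist ((f ^^ n) y) ((f ^^ n) x) < \<alpha>)"
    unfolding eventually_at by blast
  then show ?thesis
    using \<open>\<alpha> > 0\<close> by (intro exI[of _ \<delta>]) (force simp: dist_real_def abs_minus_commute)
qed

text \<open>The map may reverse orientation, so that orbits need not converge; its square preserves
  orientation, and that gives convergence along even and along odd times.\<close>

lemma inj_interval_map_two_step_tendsto_0:
  fixes f :: "real \<Rightarrow> real"
  assumes cont: "continuous_on {a..b} f" and into: "f ` {a..b} \<subseteq> {a..b}"
    and inj: "inj_on f {a..b}" and x: "x \<in> {a..b}"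
  shows "(\<lambda>n. (f ^^ (n + 2)) x - (f ^^ n) x) \<longlonglongrightarrow> 0"
proof -
  define z where "z k = (f ^^ (2 * k)) x" for k
  have z_in: "z k \<in> {a..b}" for k
    unfolding z_def by (intro funpow_maps_to into x)
  have z_Suc: "z (Suc k) = f (f (z k))" for k
    by (simp add: z_def)
  have "strict_mono_on {a..b} f \<or> strict_antimono_on {a..b} f"
    using injective_eq_monotone_map[of "{a..b}" f] cont inj by (simp add: is_interval_cc)
  moreover have "f (z k) \<in> {a..b}" for k
    using into z_in by blast
  ultimately have step: "z (Suc i) \<le> z (Suc j)" if "z i \<le> z j" for i j
    using that z_in unfolding z_Suc monotone_on_def order_le_less by metis
  have "monoseq z"
  proof (cases "z 0 \<le> z (Suc 0)")
    case True
    have "z k \<le> z (Suc k)" for k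
      by (induction k) (use True in \<open>auto intro: step\<close>)
    then show ?thesis by (simp add: monoseq_Suc)
  next
    case False
    have "z (Suc k) \<le> z k" for k
      by (induction k) (use False in \<open>auto intro: step\<close>)
    then show ?thesis by (simp add: monoseq_Suc)
  qed
  moreover have "Bseq z"
    using z_in by (intro BseqI'[of _ "\<bar>a\<bar> + \<bar>b\<bar>"]) (smt (verit) atLeastAtMost_iff real_norm_def)
  ultimately obtain L where L: "z \<longlonglongrightarrow> L"
    using Bseq_monoseq_convergent unfolding convergent_def by blast
  have "L \<in> {a..b}"
    using closed_sequentially[OF closed_atLeastAtMost, of z a b L] z_in L by simp
  then have fL: "(\<lambda>k. f (z k)) \<longlonglongrightarrow> f L"
    using continuous_on_tendsto_compose[OF cont L] z_in by simp
  have even: "(\<lambda>k. z (Suc k) - z k) \<longlonglongrightarrow> 0"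
    using tendsto_diff[OF LIMSEQ_Suc[OF L] L] by simp
  have odd: "(\<lambda>k. f (z (Suc k)) - f (z k)) \<longlonglongrightarrow> 0"
    using tendsto_diff[OF LIMSEQ_Suc[OF fL] fL] by simp
  show ?thesis
  proof (rule LIMSEQ_I)
    fix e :: real assume "e > 0"
    obtain K where K: "\<And>k. k \<ge> K \<Longrightarrow> \<bar>z (Suc k) - z k\<bar> < e"
      using LIMSEQ_D[OF even \<open>e > 0\<close>] by auto
    obtain M where M: "\<And>k. k \<ge> M \<Longrightarrow> \<bar>f (z (Suc k)) - f (z k)\<bar> < e"
      using LIMSEQ_D[OF odd \<open>e > 0\<close>] by auto
    have "norm ((f ^^ (n + 2)) x - (f ^^ n) x - 0) < e" if n: "n \<ge> 2 * (K + M)" for n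
    proof (cases "even n")
      case True
      then obtain k where "n = 2 * k" by (elim evenE)
      with K[of k] n show ?thesis by (simp add: z_def)
    next
      case False
      then obtain k where "n = 2 * k + 1" by (elim oddE)
      with M[of k] n show ?thesis by (simp add: z_def)
    qed
    then show "\<exists>N. \<forall>n\<ge>N. norm ((f ^^ (n + 2)) x - (f ^^ n) x - 0) < e"
      by blast
  qed
qed

text \<open>Injectivity of the iterates keeps the orbit of a point between \<open>x\<close> and \<open>f (f x)\<close>
  squeezed between the orbits of those two, whose distance tends to \<open>0\<close>.\<close>

lemma inj_interval_map_close_orbits:
  fixes f :: "real \<Rightarrow> real"
  assumes "a < b" and cont: "continuous_on {a..b} f" and into: "f ` {a..b} \<subseteq> {a..b}"
    and inj: "inj_on f {a..b}" and "\<alpha> > 0"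
  shows "\<exists>x\<in>{a..b}. \<exists>y\<in>{a..b}. x \<noteq> y \<and> (\<forall>n. \<bar>(f ^^ n) x - (f ^^ n) y\<bar> \<le> \<alpha>)"
proof (cases "\<forall>x\<in>{a..b}. f (f x) = x")
  case True
  \<comment> \<open>No nondegenerate interval from \<open>x\<close> to \<open>f (f x)\<close> is available here, but every orbit has
    period at most two.\<close>
  have period: "(f ^^ n) x = (f ^^ (n mod 2)) x" if "x \<in> {a..b}" for n x
    using True that by (intro funpow_mod_eq[symmetric]) (simp add: numeral_2_eq_2)
  have a: "a \<in> {a..b}"
    using \<open>a < b\<close> by simp
  obtain \<delta> where \<delta>: "\<delta> > 0"
    "\<And>y n. y \<in> {a..b} \<Longrightarrow> \<bar>y - a\<bar> < \<delta> \<Longrightarrow> n < 2 \<Longrightarrow> \<bar>(f ^^ n) a - (f ^^ n) y\<bar> \<le> \<alpha>"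
    using finite_orbits_close[OF cont into a \<open>\<alpha> > 0\<close>, of 2] by blast
  define y where "y = a + min (b - a) (\<delta> / 2)"
  have y: "y \<in> {a..b}" "a \<noteq> y" "\<bar>y - a\<bar> < \<delta>"
    using \<open>a < b\<close> \<open>\<delta> > 0\<close> by (auto simp: y_def min_def)
  have "\<bar>(f ^^ n) a - (f ^^ n) y\<bar> \<le> \<alpha>" for n
    using \<delta>(2)[OF y(1,3), of "n mod 2"] period[OF a, of n] period[OF y(1), of n] by simp
  with a y show ?thesis by blast
next
  case False
  then obtain x where x: "x \<in> {a..b}" and moved: "f (f x) \<noteq> x" by blast
  define w where "w = f (f x)"
  have w: "w \<in> {a..b}" "w \<noteq> x"
    using funpow_maps_to[OF into x, of 2] moved by (simp_all add: w_def numeral_2_eq_2)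
  have orbit_w: "(f ^^ n) w = (f ^^ (n + 2)) x" for n
    by (simp add: w_def funpow_swap1)
  obtain N where N: "\<And>n. n \<ge> N \<Longrightarrow> \<bar>(f ^^ (n + 2)) x - (f ^^ n) x\<bar> < \<alpha>"
    using LIMSEQ_D[OF inj_interval_map_two_step_tendsto_0[OF cont into inj x] \<open>\<alpha> > 0\<close>] by auto
  obtain \<delta> where \<delta>: "\<delta> > 0"
    "\<And>y n. y \<in> {a..b} \<Longrightarrow> \<bar>y - x\<bar> < \<delta> \<Longrightarrow> n < N \<Longrightarrow> \<bar>(f ^^ n) x - (f ^^ n) y\<bar> \<le> \<alpha>"
    using finite_orbits_close[OF cont into x \<open>\<alpha> > 0\<close>, of N] by blast
  obtain y where y: "x < y \<and> y < w \<or> w < y \<and> y < x" "\<bar>y - x\<bar> < \<delta>"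
  proof (cases "x < w")
    case True
    then show ?thesis
      using \<open>\<delta> > 0\<close> that[of "x + min ((w - x) / 2) (\<delta> / 2)"] by (auto simp: min_def field_simps)
  next
    case False
    then show ?thesis
      using w \<open>\<delta> > 0\<close> that[of "x - min ((x - w) / 2) (\<delta> / 2)"] by (auto simp: min_def field_simps)
  qed
  have y_in: "y \<in> {a..b}"
    using y x w by auto
  have late: "\<bar>(f ^^ n) x - (f ^^ n) y\<bar> \<le> \<alpha>" if "n \<ge> N" for n
  proof -
    have squeeze: "(f ^^ n) p < (f ^^ n) y \<and> (f ^^ n) y < (f ^^ n) q \<or>
                   (f ^^ n) q < (f ^^ n) y \<and> (f ^^ n) y < (f ^^ n) p"
      if "p < y" "y < q" "p \<in> {a..b}" "q \<in> {a..b}" for p q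
      using that
      by (intro continuous_inj_imp_mono continuous_on_subset[OF continuous_on_funpow[OF cont into]]
            inj_on_subset[OF inj_on_funpow[OF inj into]]) auto
    have "\<bar>(f ^^ n) x - (f ^^ n) y\<bar> \<le> \<bar>(f ^^ n) w - (f ^^ n) x\<bar>"
      using squeeze[of x w] squeeze[of w x] y(1) x w(1) by linarith
    then show ?thesis
      using N[OF that] unfolding orbit_w by linarith
  qed
  have "\<bar>(f ^^ n) x - (f ^^ n) y\<bar> \<le> \<alpha>" for n
    using late \<delta>(2)[OF y_in y(2)] by (cases "n < N") auto
  moreover have "x \<noteq> y"
    using y(1) by auto
  ultimately show ?thesis
    using x y_in by blast
qed

text \<open>A map violating injectivity at scale \<open>\<alpha>\<close> identifies two nearby points after one step;
  any other map is injective.\<close>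

lemma interval_map_close_orbits:
  fixes f :: "real \<Rightarrow> real"
  assumes "a < b" "continuous_on {a..b} f" "f ` {a..b} \<subseteq> {a..b}" "\<alpha> > 0"
  shows "\<exists>x\<in>{a..b}. \<exists>y\<in>{a..b}. x \<noteq> y \<and> (\<forall>n. \<bar>(f ^^ n) x - (f ^^ n) y\<bar> \<le> \<alpha>)"
proof (cases "\<exists>x\<in>{a..b}. \<exists>y\<in>{a..b}. \<bar>x - y\<bar> \<le> \<alpha> \<and> f x = f y \<and> x \<noteq> y")
  case True
  then obtain x y where xy: "x \<in> {a..b}" "y \<in> {a..b}" "\<bar>x - y\<bar> \<le> \<alpha>" "f x = f y" "x \<noteq> y"
    by blast
  have "\<bar>(f ^^ n) x - (f ^^ n) y\<bar> \<le> \<alpha>" for n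
    using xy \<open>\<alpha> > 0\<close> by (cases n) (auto simp: funpow_Suc_right simp del: funpow.simps(2))
  with xy show ?thesis by blast
next
  case False
  then have "inj_on f {a..b}"
    using assms by (intro locally_injective_imp_inj_on_interval[of a b f \<alpha>]) auto
  then show ?thesis
    using inj_interval_map_close_orbits assms by blast
qed

theorem corollary6:
  shows "typically (mtopology_of C01) (\<lambda>f. \<not> expansive_in_future f)"
proof -
  have "\<not> expansive_in_future f" if "f \<in> mspace C01" for f
  proof
    assume "expansive_in_future f"
    then obtain \<alpha> where "\<alpha> > 0" and
      "\<forall>x\<in>{0..1}. \<forall>y\<in>{0..1}. (\<forall>n. \<bar>(f ^^ n) x - (f ^^ n) y\<bar> \<le> \<alpha>) \<longrightarrow> x = y"
      unfolding expansive_in_future_def by blast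
    moreover have "continuous_on {0..1} f" "f ` {0..1} \<subseteq> {0..1}"
      using that by (auto simp: mspace_C01)
    ultimately show False
      using interval_map_close_orbits[of 0 1 f \<alpha>] by (meson zero_less_one)
  qed
  then have "\<forall>f\<in>topspace (mtopology_of C01). \<not> expansive_in_future f"
    by simp
  then show ?thesis
    unfolding typically_def
    by (intro exI[of _ "topspace (mtopology_of C01)"] conjI gdelta_in_topspace closure_of_topspace)
qed

end
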